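(* Let $(X,\rho)$ be a metric space with a positive $\sigma$-finite Borel measure $dx$, let $x_0\in X$, and let $B_r=\{x\in X:\rho(x,x_0)<r\}$, where $|B_{1/2}|>0$ and $|B_1|<\infty$. Let $1\le p<\infty$ and let $\phi=\Phi(\rho(\cdot,x_0))$ be a radially decreasing weight on $B_1$. Assume that for some measurable kernel $k:B_1\times B_1\to[0,\infty)$ and some constant $C>0$ the inequality $$\int_{B_r}|u(x)-u_{B_r}|^p\,dx\le C\int_{B_r}\int_{B_r}|u(x)-u(y)|^p\,k(x,y)\,dy\,dx$$ holds whenever $r\in(\tfrac12,1]$ and $u\in L^p(X)$. Then, with $M=\frac{8^p|B_1|}{|B_{1/2}|}\,\frac{\Phi(0)}{\Phi(1/2)}$, $$\int_{B_1}|u(x)-u_{B_1}^\phi|^p\,\phi(x)\,dx\le C\,M\int_{B_1}\int_{B_1}|u(x)-u(y)|^p\,k(x,y)\,(\phi(y)\wedge\phi(x))\,dy\,dx$$ for every $u\in L^p(X)$.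
   Context: Functions are real-valued and $a\wedge b=\min(a,b)$. $|E|=\int_E dx$ is the measure of a Borel set $E$, and $\overline{B}_r=\{x\in X:\rho(x,x_0)\le r\}$. A function $\phi:B_1\to[0,\infty)$ is a radially decreasing weight if $\phi(x)=\Phi(\rho(x,x_0))$ for a profile $\Phi:[0,1)\to[0,\infty)$ that is nonincreasing and right-continuous with left limits, and $\phi$ is not identically zero on $B_1\setminus\overline{B}_{1/2}$ (so $\Phi(1/2)>0$). The means are $u_E=\frac1{|E|}\int_E u(x)\,dx$ and $u_E^\phi=\frac{\int_E u(x)\phi(x)\,dx}{\int_E\phi(x)\,dx}$ for $E\subset B_1$. Integrals of nonnegative functions may equal $+\infty$. *)

theory Defs
  imports "HOL-Analysis.Analysis"
begin

definition Lp_function :: "'a measure \<Rightarrow> real \<Rightarrow> ('a \<Rightarrow> real) \<Rightarrow> bool" where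
  "Lp_function M p u \<longleftrightarrow>
     u \<in> borel_measurable M \<and> integrable M (\<lambda>x. \<bar>u x\<bar> powr p)"

definition mean_on :: "'a measure \<Rightarrow> 'a set \<Rightarrow> ('a \<Rightarrow> real) \<Rightarrow> real" where
  "mean_on M E u = (1 / measure M E) * (LINT x:E|M. u x)"

definition weighted_mean_on ::
  "'a measure \<Rightarrow> ('a \<Rightarrow> real) \<Rightarrow> 'a set \<Rightarrow> ('a \<Rightarrow> real) \<Rightarrow> real" where
  "weighted_mean_on M \<phi> E u = (LINT x:E|M. u x * \<phi> x) / (LINT x:E|M. \<phi> x)"

text \<open>The profile is a function on $[0,1)$, so its values outside this interval are
  unconstrained; the one-sided limits below only depend on its values inside.\<close>

definition radial_profile :: "(real \<Rightarrow> real) \<Rightarrow> bool" where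
  "radial_profile \<Phi> \<longleftrightarrow>
     (\<forall>t\<in>{0..<1}. 0 \<le> \<Phi> t) \<and>
     antimono_on {0..<1} \<Phi> \<and>
     (\<forall>t\<in>{0..<1}. continuous (at_right t) \<Phi>) \<and>
     (\<forall>t\<in>{0<..<1}. \<exists>l. (\<Phi> \<longlongrightarrow> l) (at_left t))"

definition radially_decreasing_weight ::
  "'a::metric_space \<Rightarrow> (real \<Rightarrow> real) \<Rightarrow> ('a \<Rightarrow> real) \<Rightarrow> bool" where
  "radially_decreasing_weight x0 \<Phi> \<phi> \<longleftrightarrow>
     radial_profile \<Phi> \<and>
     (\<forall>x\<in>ball x0 1. \<phi> x = \<Phi> (dist x x0)) \<and>
     (\<exists>x\<in>ball x0 1 - cball x0 (1/2). \<phi> x \<noteq> 0)"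

end

theory Submission
  imports Defs
begin

text \<open>Right-continuity and monotonicity of the profile make every superlevel set
  $\{\phi > s\}$ in $B_1$ an open ball around $x_0$, of radius in $(1/2, 1]$ when
  $s < a = \Phi(1/2)$. Replacing $\phi$ by $g = \phi \wedge a$ costs the factor
  $\Phi(0)/a$; then $g(x) = \int_0^a 1_{\phi > s}(x)\,ds$ and
  $g(x) \wedge g(y) = \int_0^a 1_{\phi > s}(x) 1_{\phi > s}(y)\,ds$, so that the unweighted
  inequality on the balls $\{\phi > s\}$ integrates to the weighted one. All these balls contain
  $B_{1/2}$, so $u_{B_{1/2}}$ can serve as the common centre, at the cost of a factor
  $2^p |B_1|/|B_{1/2}|$; exchanging it for the weighted mean costs another $2^p$.\<close>

section \<open>Convexity of powers and the change of centre in p-th power deviations\<close>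

text \<open>The graph of a convex function lies above its tangents. The derivative rule is applied
  on the open half-line, so \<open>b = 0\<close> and \<open>t = 0\<close> are checked by hand; at
  \<open>b = 0\<close> the convention \<open>0 powr q = 0\<close> makes the left side vanish, also
  for \<open>p = 1\<close>.\<close>

lemma powr_tangent_le:
  fixes p b t :: real
  assumes "1 \<le> p" "0 \<le> b" "0 \<le> t"
  shows "b powr p + p * b powr (p - 1) * (t - b) \<le> t powr p"
proof (cases "b = 0 \<or> t = 0")
  case True
  have "b powr p = b powr (p - 1) * b" if "b > 0"
    using that by (simp add: powr_diff)
  then show ?thesis
    using True assms by (cases "b = 0") (auto simp: mult_right_mono)
next
  case False
  then have b: "b > 0" and t: "t > 0" using assms by auto
  have "t powr p - b powr p \<ge> p * b powr (p - 1) * (t - b)"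
  proof (rule convex_on_imp_above_tangent[where A = "{0<..}"])
    show "convex_on {0<..} (\<lambda>x::real. x powr p)"
      using convex_on_subset[OF powr_convex[OF assms(1)]] by (auto intro: convex_on_subset)
    show "((\<lambda>x. x powr p) has_real_derivative p * b powr (p - 1)) (at b within {0<..})"
      using b by (auto intro!: derivative_eq_intros)
  qed (use b t in \<open>auto simp: interior_open\<close>)
  then show ?thesis by simp
qed

text \<open>Add the tangent inequalities at the midpoint \<open>m\<close>, evaluated at
  \<open>a\<close> and at \<open>b\<close>: the two linear terms cancel.\<close>

lemma powr_add_le:
  fixes p a b :: real
  assumes "1 \<le> p" "0 \<le> a" "0 \<le> b"
  shows "(a + b) powr p \<le> 2 powr (p - 1) * (a powr p + b powr p)"
proof -
  define m where "m = (a + b) / 2"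
  have "m powr p + p * m powr (p - 1) * (a - m) \<le> a powr p"
    "m powr p + p * m powr (p - 1) * (b - m) \<le> b powr p"
    using assms by (intro powr_tangent_le; simp add: m_def)+
  moreover have "p * m powr (p - 1) * (a - m) + p * m powr (p - 1) * (b - m) = 0"
    unfolding m_def by (simp add: field_simps)
  ultimately have "2 * m powr p \<le> a powr p + b powr p" by linarith
  then have "2 powr (p - 1) * (2 * m powr p) \<le> 2 powr (p - 1) * (a powr p + b powr p)"
    by (rule mult_left_mono) simp
  moreover have "(a + b) powr p = 2 powr (p - 1) * (2 * m powr p)"
    using assms by (simp add: m_def powr_divide powr_diff)
  ultimately show ?thesis by simp
qed

text \<open>Jensen's inequality for the measure with density \<open>v\<close>, multiplied by the
  total weight. It follows by integrating a tangent inequality; the right side is an extended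
  integral, so the non-integrable case is trivial.\<close>

lemma jensen_powr_weighted:
  fixes f v :: "'a \<Rightarrow> real"
  assumes p: "1 \<le> p" and f [measurable]: "f \<in> borel_measurable M"
    and v: "integrable M v" and v0: "\<And>x. 0 \<le> v x"
    and fv: "integrable M (\<lambda>x. f x * v x)" and V: "0 < (LINT x|M. v x)"
  shows "ennreal (\<bar>(LINT x|M. f x * v x) / (LINT x|M. v x)\<bar> powr p * (LINT x|M. v x))
    \<le> (\<integral>\<^sup>+x. ennreal (\<bar>f x\<bar> powr p * v x) \<partial>M)"
proof (cases "integrable M (\<lambda>x. \<bar>f x\<bar> powr p * v x)")
  case True
  have [measurable]: "v \<in> borel_measurable M" using v by auto
  define V where "V = (LINT x|M. v x)"
  have fv': "integrable M (\<lambda>x. \<bar>f x\<bar> * v x)"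
    using integrable_norm[OF fv] v0 by (simp add: abs_mult)
  \<comment> \<open>The tangent inequality needs a nonnegative base point, hence the mean of
    \<open>\<bar>f\<bar>\<close> instead of that of \<open>f\<close>; it dominates the absolute
    value of the latter.\<close>
  define b where "b = (LINT x|M. \<bar>f x\<bar> * v x) / V"
  have b0: "0 \<le> b" using v0 V by (auto simp: b_def V_def intro!: divide_nonneg_pos)
  have "\<bar>LINT x|M. f x * v x\<bar> \<le> (LINT x|M. \<bar>f x\<bar> * v x)"
    using integral_norm_bound[of M "\<lambda>x. f x * v x"] v0 by (simp add: abs_mult)
  then have ab: "\<bar>(LINT x|M. f x * v x) / V\<bar> \<le> b"
    using V by (simp add: b_def V_def abs_divide divide_right_mono)
  \<comment> \<open>By the choice of \<open>b\<close>, the linear term integrates to zero.\<close>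
  have "b powr p * V = (LINT x|M. b powr p * v x + p * b powr (p - 1) * (\<bar>f x\<bar> * v x - b * v x))"
    using v fv' V by (simp add: b_def V_def)
  also have "\<dots> \<le> (LINT x|M. \<bar>f x\<bar> powr p * v x)"
  proof (rule integral_mono)
    show "b powr p * v x + p * b powr (p - 1) * (\<bar>f x\<bar> * v x - b * v x) \<le> \<bar>f x\<bar> powr p * v x" for x
      using mult_right_mono[OF powr_tangent_le[OF p b0 abs_ge_zero[of "f x"]] v0[of x]]
      by (simp add: algebra_simps)
  qed (use v fv' True in auto)
  finally have bV: "b powr p * V \<le> (LINT x|M. \<bar>f x\<bar> powr p * v x)" .
  have "\<bar>(LINT x|M. f x * v x) / V\<bar> powr p * V \<le> b powr p * V"
    using p V ab by (intro mult_right_mono powr_mono2) (auto simp: V_def)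
  also note bV
  finally have "\<bar>(LINT x|M. f x * v x) / V\<bar> powr p * V \<le> (LINT x|M. \<bar>f x\<bar> powr p * v x)" .
    then show ?thesis
    using True v0 by (subst nn_integral_eq_integral) (auto simp: V_def intro: ennreal_leI)
next
  case False
  have [measurable]: "v \<in> borel_measurable M" using v by auto
  have "(\<integral>\<^sup>+x. ennreal (\<bar>f x\<bar> powr p * v x) \<partial>M) = \<infinity>"
    using False v0 by (intro nn_integral_nonneg_infinite) auto
  then show ?thesis by simp
qed

text \<open>An arbitrary centre \<open>a\<close> is exchanged for the \<open>v\<close>-mean
  \<open>c\<close> of \<open>f\<close>. Split \<open>f - c\<close> into \<open>f - a\<close> and
  \<open>a - c\<close>; Jensen for \<open>f - a\<close> bounds the constant part in the weight
  \<open>v\<close>, and the passage from \<open>v\<close> to \<open>w\<close> costs the ratio of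
  total weights. The freedom \<open>v \<le> w\<close> allows a mean over a small ball to be used on
  a larger one.\<close>

lemma weighted_mean_deviation_le:
  fixes f v w :: "'a \<Rightarrow> real"
  assumes p: "1 \<le> p" and f [measurable]: "f \<in> borel_measurable M"
    and v: "integrable M v" and w: "integrable M w"
    and v0: "\<And>x. 0 \<le> v x" and vw: "\<And>x. v x \<le> w x"
    and fv: "integrable M (\<lambda>x. f x * v x)" and V: "0 < (LINT x|M. v x)"
  shows "(\<integral>\<^sup>+x. ennreal (\<bar>f x - (LINT x|M. f x * v x) / (LINT x|M. v x)\<bar> powr p * w x) \<partial>M)
    \<le> ennreal (2 powr p * ((LINT x|M. w x) / (LINT x|M. v x)))
        * (\<integral>\<^sup>+x. ennreal (\<bar>f x - a\<bar> powr p * w x) \<partial>M)"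
proof -
  have [measurable]: "v \<in> borel_measurable M" "w \<in> borel_measurable M" using v w by auto
  define V where "V = (LINT x|M. v x)"
  define W where "W = (LINT x|M. w x)"
  define c where "c = (LINT x|M. f x * v x) / V"
  define I where "I = (\<integral>\<^sup>+x. ennreal (\<bar>f x - a\<bar> powr p * w x) \<partial>M)"
  have w0: "0 \<le> w x" for x using v0 vw order_trans by blast
  have V0: "0 < V" using V by (simp add: V_def)
  have VW: "V \<le> W" unfolding V_def W_def by (rule integral_mono[OF v w vw])
  have "(LINT x|M. (f x - a) * v x) = c * V - a * V"
    using v fv V0 by (simp add: left_diff_distrib c_def V_def)
  then have ca: "(LINT x|M. (f x - a) * v x) / V = c - a"
    using V0 by (simp add: field_simps)
  have J: "ennreal (\<bar>c - a\<bar> powr p * V) \<le> I"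
  proof -
    have "ennreal (\<bar>c - a\<bar> powr p * V) \<le> (\<integral>\<^sup>+x. ennreal (\<bar>f x - a\<bar> powr p * v x) \<partial>M)"
      using jensen_powr_weighted[of p "\<lambda>x. f x - a" M v, folded V_def, unfolded ca] p v v0 fv V0
      by (simp add: left_diff_distrib)
    also have "\<dots> \<le> I" unfolding I_def
      by (intro nn_integral_mono ennreal_leI mult_left_mono vw) simp
    finally show ?thesis .
  qed
  have "(\<integral>\<^sup>+x. ennreal (\<bar>f x - c\<bar> powr p * w x) \<partial>M)
      \<le> (\<integral>\<^sup>+x. ennreal (2 powr (p - 1)) * (ennreal (\<bar>f x - a\<bar> powr p * w x)
              + ennreal (\<bar>c - a\<bar> powr p * w x)) \<partial>M)"
  proof (rule nn_integral_mono)
    fix x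
    have "\<bar>f x - c\<bar> powr p \<le> (\<bar>f x - a\<bar> + \<bar>c - a\<bar>) powr p"
      using p by (intro powr_mono2) auto
    also have "\<dots> \<le> 2 powr (p - 1) * (\<bar>f x - a\<bar> powr p + \<bar>c - a\<bar> powr p)"
      using p by (intro powr_add_le) auto
    finally have "\<bar>f x - c\<bar> powr p * w x \<le> 2 powr (p - 1) * (\<bar>f x - a\<bar> powr p + \<bar>c - a\<bar> powr p) * w x"
      using w0 by (rule mult_right_mono)
    then show "ennreal (\<bar>f x - c\<bar> powr p * w x) \<le> ennreal (2 powr (p - 1)) * (ennreal (\<bar>f x - a\<bar> powr p * w x)
              + ennreal (\<bar>c - a\<bar> powr p * w x))"
      using w0 by (simp add: ennreal_mult[symmetric] ennreal_plus[symmetric] ennreal_leI algebra_simps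
          del: ennreal_plus)
  qed
  also have "\<dots> = ennreal (2 powr (p - 1)) * (I + ennreal (\<bar>c - a\<bar> powr p * W))"
    using w w0 by (simp add: nn_integral_cmult nn_integral_add I_def W_def nn_integral_eq_integral)
  \<comment> \<open>Since \<open>V \<le> W\<close>, both summands are at most \<open>W / V\<close>
    times \<open>I\<close>, so the constant \<open>2 powr (p - 1)\<close> doubles to
    \<open>2 powr p\<close>.\<close>
  also have "\<dots> \<le> ennreal (2 powr (p - 1)) * (ennreal (W / V) * I + ennreal (W / V) * I)"
  proof (intro mult_left_mono add_mono)
    show "I \<le> ennreal (W / V) * I"
      using mult_right_mono[of 1 "ennreal (W / V)" I] VW V0 by (simp add: ennreal_ge_1)
    have "ennreal (\<bar>c - a\<bar> powr p * W) = ennreal (W / V) * ennreal (\<bar>c - a\<bar> powr p * V)"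
      using V0 VW by (simp add: ennreal_mult[symmetric])
    also have "\<dots> \<le> ennreal (W / V) * I" by (intro mult_left_mono J) simp
    finally show "ennreal (\<bar>c - a\<bar> powr p * W) \<le> ennreal (W / V) * I" .
  qed simp
  also have "\<dots> = ennreal (2 powr (p - 1)) * (ennreal 2 * (ennreal (W / V) * I))"
    by (simp add: mult_2)
  also have "\<dots> = ennreal (2 powr (p - 1) * 2 * (W / V)) * I"
    using V0 VW by (simp add: ennreal_mult mult.assoc del: times_divide_eq_right times_divide_eq_left)
  also have "2 powr (p - 1) * 2 = (2::real) powr p"
    by (simp add: powr_diff)
  finally show ?thesis unfolding c_def I_def V_def W_def .
qed

section \<open>Level sets: the layer-cake formula and superlevel balls of a radial profile\<close>

text \<open>The factor \<open>ennreal (g z)\<close> is the length of the interval from 0 to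
  \<open>g z\<close>, and Tonelli swaps the integrals. Where \<open>g\<close> is negative,
  \<open>ennreal\<close> truncates to 0 and the interval is empty.\<close>

lemma nn_integral_layer_cake:
  fixes F :: "'a \<Rightarrow> ennreal" and g :: "'a \<Rightarrow> real"
  assumes "sigma_finite_measure N"
    and [measurable]: "F \<in> borel_measurable N" "g \<in> borel_measurable N"
  shows "(\<integral>\<^sup>+z. F z * ennreal (g z) \<partial>N)
    = (\<integral>\<^sup>+s. (\<integral>\<^sup>+z. F z * indicator {z. 0 < s \<and> s < g z} z \<partial>N) \<partial>lborel)"
proof -
  interpret N: sigma_finite_measure N by fact
  interpret pair_sigma_finite N lborel ..
  have "(\<integral>\<^sup>+z. F z * ennreal (g z) \<partial>N)
      = (\<integral>\<^sup>+z. (\<integral>\<^sup>+s. F z * indicator {0<..<g z} s \<partial>lborel) \<partial>N)"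
  proof (rule nn_integral_cong)
    fix z
    show "F z * ennreal (g z) = (\<integral>\<^sup>+s. F z * indicator {0<..<g z} s \<partial>lborel)"
      by (cases "0 \<le> g z") (simp_all add: nn_integral_cmult_indicator ennreal_neg)
  qed
  also have "\<dots> = (\<integral>\<^sup>+z. (\<integral>\<^sup>+s. F z * indicator {z. 0 < s \<and> s < g z} z \<partial>lborel) \<partial>N)"
    by (intro nn_integral_cong) (auto simp: indicator_def)
  also have "\<dots> = (\<integral>\<^sup>+s. (\<integral>\<^sup>+z. F z * indicator {z. 0 < s \<and> s < g z} z \<partial>N) \<partial>lborel)"
    by (rule Fubini'[symmetric]) (simp add: indicator_def case_prod_beta)
  finally show ?thesis .
qed


text \<open>Right-continuity carries the strict inequality a little beyond \<open>t\<close>.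
  Superlevel sets of the profile thus have no largest element, which makes the corresponding balls
  open.\<close>

lemma radial_profile_superlevel_step:
  assumes "radial_profile \<Phi>" "0 \<le> t" "t < 1" "s < \<Phi> t"
  obtains t' where "t < t'" "t' < 1" "s < \<Phi> t'"
proof -
  have "(\<Phi> \<longlongrightarrow> \<Phi> t) (at_right t)"
    using assms by (auto simp: radial_profile_def continuous_within)
  then have "\<forall>\<^sub>F y in at_right t. s < \<Phi> y"
    using assms(4) by (rule order_tendstoD)
  moreover have "\<forall>\<^sub>F y in at_right t. y \<in> {t<..<1}"
    using assms(3) by (rule eventually_at_right_real)
  ultimately have "\<forall>\<^sub>F y in at_right t. t < y \<and> y < 1 \<and> s < \<Phi> y"
    by eventually_elim auto
  then obtain y where "t < y \<and> y < 1 \<and> s < \<Phi> y"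
    using eventually_happens'[OF trivial_limit_at_right_real] by blast
  then show thesis using that by blast
qed

lemma radial_profile_antimono:
  assumes "radial_profile \<Phi>" "0 \<le> s" "s \<le> t" "t < 1"
  shows "\<Phi> t \<le> \<Phi> s"
  using assms by (auto simp: radial_profile_def monotone_on_def)

text \<open>Gives measurability of the superlevel sets at every level \<open>s\<close>: around
  \<open>x0\<close>, a ball of slightly larger radius than \<open>dist x x0\<close> stays inside by
  monotonicity.\<close>

lemma open_radial_superlevel:
  fixes x0 :: "'a::metric_space"
  assumes \<Phi>: "radial_profile \<Phi>"
  shows "open {x \<in> ball x0 1. s < \<Phi> (dist x x0)}"
proof (rule Topological_Spaces.openI)
  fix x assume "x \<in> {x \<in> ball x0 1. s < \<Phi> (dist x x0)}"
  then have "dist x x0 < 1" "s < \<Phi> (dist x x0)" by (auto simp: dist_commute)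
  with \<Phi> obtain t where t: "dist x x0 < t" "t < 1" "s < \<Phi> t"
    by (metis radial_profile_superlevel_step zero_le_dist)
  have "ball x0 t \<subseteq> {x \<in> ball x0 1. s < \<Phi> (dist x x0)}"
    using t radial_profile_antimono[OF \<Phi>, of "dist _ x0" t]
    by (force simp: dist_commute intro: less_le_trans)
  then show "\<exists>T. open T \<and> x \<in> T \<and> T \<subseteq> {x \<in> ball x0 1. s < \<Phi> (dist x x0)}"
    using t by (intro exI[of _ "ball x0 t"]) (auto simp: dist_commute)
qed

text \<open>The radius is the supremum of the radii at which the profile exceeds \<open>s\<close>.
  Monotonicity puts every smaller radius in this set \<open>S\<close>, and the supremum is not
  attained, so the ball is open; as \<open>1/2\<close> lies in \<open>S\<close>, it also exceeds
  \<open>1/2\<close> strictly.\<close>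

lemma radial_superlevel_eq_ball:
  fixes x0 :: "'a::metric_space"
  assumes \<Phi>: "radial_profile \<Phi>" and s: "s < \<Phi> (1/2)"
  obtains r where "1/2 < r" "r \<le> 1" "{x \<in> ball x0 1. s < \<Phi> (dist x x0)} = ball x0 r"
proof
  define S where "S = {t\<in>{0..<1}. s < \<Phi> t}"
  have half: "1/2 \<in> S" using s by (simp add: S_def)
  have bdd: "bdd_above S" by (auto simp: S_def intro!: bdd_aboveI[of _ 1])
  have lt: "t < Sup S" if t: "t \<in> S" for t
  proof -
    obtain t' where "t < t'" "t' < 1" "s < \<Phi> t'"
      using t radial_profile_superlevel_step[OF \<Phi>, of t s] by (auto simp: S_def)
    then show ?thesis
      using t by (intro less_le_trans[OF \<open>t < t'\<close>] cSup_upper bdd) (auto simp: S_def)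
  qed
  have mem: "t \<in> S" if t: "0 \<le> t" "t < Sup S" for t
  proof -
    obtain t' where "t' \<in> S" "t < t'"
      using t half less_cSup_iff[OF _ bdd] by auto
    then show ?thesis
      using radial_profile_antimono[OF \<Phi>, of t t'] t by (auto simp: S_def)
  qed
  show "1/2 < Sup S" by (rule lt[OF half])
  show "Sup S \<le> 1" using half by (intro cSup_least) (blast, simp add: S_def)
  have "x \<in> ball x0 1 \<and> s < \<Phi> (dist x x0) \<longleftrightarrow> dist x x0 \<in> S" for x
    by (auto simp: S_def dist_commute)
  then show "{x \<in> ball x0 1. s < \<Phi> (dist x x0)} = ball x0 (Sup S)"
    using lt mem by (auto simp: dist_commute)
qed

theorem proposition4:
  fixes M :: "'a::metric_space measure"
    and x0 :: 'a
    and p C :: real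
    and \<Phi> :: "real \<Rightarrow> real"
    and \<phi> :: "'a \<Rightarrow> real"
    and k :: "'a \<Rightarrow> 'a \<Rightarrow> real"
  assumes "sets M = sets borel"
    and "sigma_finite_measure M"
    and "emeasure M (ball x0 (1/2)) > 0"
    and "emeasure M (ball x0 1) < \<infinity>"
    and "1 \<le> p"
    and "radially_decreasing_weight x0 \<Phi> \<phi>"
    and "(\<lambda>(x, y). k x y) \<in>
           borel_measurable (restrict_space (M \<Otimes>\<^sub>M M) (ball x0 1 \<times> ball x0 1))"
    and "\<And>x y. x \<in> ball x0 1 \<Longrightarrow> y \<in> ball x0 1 \<Longrightarrow> 0 \<le> k x y"
    and "C > 0"
    and "\<And>r u. 1/2 < r \<Longrightarrow> r \<le> 1 \<Longrightarrow> Lp_function M p u \<Longrightarrow>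
           (\<integral>\<^sup>+x\<in>ball x0 r. ennreal (\<bar>u x - mean_on M (ball x0 r) u\<bar> powr p) \<partial>M)
           \<le> ennreal C *
             (\<integral>\<^sup>+x\<in>ball x0 r. (\<integral>\<^sup>+y\<in>ball x0 r.
                 ennreal (\<bar>u x - u y\<bar> powr p * k x y) \<partial>M) \<partial>M)"
  shows "\<forall>u. Lp_function M p u \<longrightarrow>
           (\<integral>\<^sup>+x\<in>ball x0 1.
               ennreal (\<bar>u x - weighted_mean_on M \<phi> (ball x0 1) u\<bar> powr p * \<phi> x) \<partial>M)
           \<le> ennreal (C * (8 powr p * measure M (ball x0 1) / measure M (ball x0 (1/2))
                            * (\<Phi> 0 / \<Phi> (1/2)))) *
             (\<integral>\<^sup>+x\<in>ball x0 1. (\<integral>\<^sup>+y\<in>ball x0 1.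
                 ennreal (\<bar>u x - u y\<bar> powr p * k x y * min (\<phi> y) (\<phi> x)) \<partial>M) \<partial>M)"
proof (intro allI impI)
  fix u assume Lp: "Lp_function M p u"
  interpret M: sigma_finite_measure M by fact
  interpret MM: pair_sigma_finite M M ..
  note [measurable_cong] = assms(1)
  note p = assms(5)
  define B where "B = ball x0 1"
  define H where "H = ball x0 (1/2)"
  \<comment> \<open>\<open>\<phi>\<close> is constrained on \<open>B\<close> only;
    \<open>\<psi>\<close> is its extension by zero.\<close>
  define \<psi> where "\<psi> = (\<lambda>x. indicator B x * \<phi> x)"
  define a where "a = \<Phi> (1/2)"
  define D where "D = \<Phi> 0 / a"
  \<comment> \<open>Truncation at \<open>a\<close> confines the levels to \<open>s < a\<close>,
    where the superlevel sets are balls of radius above \<open>1/2\<close>.\<close>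
  define g where "g = (\<lambda>x. min a (\<psi> x))"
  define E where "E = (\<lambda>s. {x \<in> B. s < \<phi> x})"
  define Q where "Q = measure M B / measure M H"
  have [simp]: "space M = UNIV" using sets_eq_imp_space_eq[OF assms(1)] by simp
  have meas_ball [measurable]: "ball x0 r \<in> sets M" for r by (simp add: assms(1))
  have [measurable]: "B \<in> sets M" "H \<in> sets M" by (simp_all add: B_def H_def)
  have u [measurable]: "u \<in> borel_measurable M" using Lp by (simp add: Lp_function_def)

  \<comment> \<open>Bounds and measurability of the weight and its truncation\<close>
  have \<Phi>: "radial_profile \<Phi>" and \<phi>: "\<And>x. x \<in> B \<Longrightarrow> \<phi> x = \<Phi> (dist x x0)"
    using assms(6) by (auto simp: radially_decreasing_weight_def B_def)
  have \<Phi>0: "0 \<le> \<Phi> t" if "0 \<le> t" "t < 1" for t using \<Phi> that by (simp add: radial_profile_def)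
  have B_dist: "x \<in> B \<longleftrightarrow> dist x x0 < 1" for x by (simp add: B_def dist_commute)
  have a0: "0 < a"
  proof -
    obtain x where x: "x \<in> B" "1/2 < dist x x0" "\<phi> x \<noteq> 0"
      using assms(6) by (auto simp: radially_decreasing_weight_def B_def dist_commute not_le)
    then have "0 < \<Phi> (dist x x0)" using \<Phi>0[of "dist x x0"] \<phi>[of x] by (force simp: B_dist)
    also have "\<dots> \<le> a" unfolding a_def
      using x by (intro radial_profile_antimono[OF \<Phi>]) (auto simp: B_dist)
    finally show ?thesis .
  qed
  have a_le: "a \<le> \<Phi> 0" unfolding a_def by (intro radial_profile_antimono[OF \<Phi>]) auto
  have D1: "1 \<le> D" using a0 a_le by (simp add: D_def)
  have \<phi>0: "0 \<le> \<phi> x" and \<phi>le: "\<phi> x \<le> \<Phi> 0" if "x \<in> B" for x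
    using that \<phi> \<Phi>0 radial_profile_antimono[OF \<Phi>, of 0 "dist x x0"] by (auto simp: B_dist)
  have \<psi>0: "0 \<le> \<psi> x" for x using \<phi>0 by (auto simp: \<psi>_def indicator_def)
  have \<psi>le: "\<psi> x \<le> \<Phi> 0" for x
    using \<phi>le a0 a_le by (auto simp: \<psi>_def indicator_def)
  have g0: "0 \<le> g x" for x using \<psi>0 a0 by (simp add: g_def)
  \<comment> \<open>Either \<open>g x = \<psi> x\<close> and \<open>1 \<le> D\<close>, or
    \<open>g x = a\<close> and \<open>\<psi> x \<le> \<Phi> 0 = D * a\<close>.\<close>
  have \<psi>g: "\<psi> x \<le> D * g x" for x
  proof (cases "\<psi> x \<le> a")
    case True
    then show ?thesis using mult_right_mono[OF D1 \<psi>0[of x]] by (simp add: g_def)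
  next
    case False
    then show ?thesis using \<psi>le[of x] a0 by (simp add: g_def D_def)
  qed
  have E_eq: "E s = {x \<in> ball x0 1. s < \<Phi> (dist x x0)}" for s
    using \<phi> by (auto simp: E_def B_def)
  have [measurable]: "E s \<in> sets M" for s
    unfolding E_eq using open_radial_superlevel[OF \<Phi>, of x0 s] by (simp add: assms(1) del: mem_ball)
  have [measurable]: "\<psi> \<in> borel_measurable M"
  proof (subst borel_measurable_iff_greater, intro allI)
    fix s :: real
    \<comment> \<open>At negative levels the points outside \<open>B\<close>, where
      \<open>\<psi>\<close> is 0, belong to the set as well.\<close>
    have "{w \<in> space M. s < \<psi> w} = (if s < 0 then UNIV else E s)"
      using \<psi>0 \<phi>0 by (auto simp: \<psi>_def E_def indicator_def intro: less_le_trans)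
    then show "{w \<in> space M. s < \<psi> w} \<in> sets M"
      using sets.top[of M] by (cases "s < 0") auto
  qed
  have [measurable]: "g \<in> borel_measurable M" unfolding g_def by measurable
  have layer: "0 < s \<and> s < g x \<longleftrightarrow> 0 < s \<and> s < a \<and> x \<in> E s" for s x
    by (auto simp: g_def \<psi>_def E_def indicator_def)

  \<comment> \<open>Finite measures and integrability\<close>
  have Bfin: "emeasure M B < \<infinity>" using assms(4) by (simp add: B_def)
  have ballfin: "emeasure M (ball x0 r) < \<infinity>" if "r \<le> 1" for r
    using that Bfin emeasure_mono[of "ball x0 r" B M] by (auto simp: B_def subset_ball intro: le_less_trans)
  have uB: "integrable M (\<lambda>x. indicator B x * u x)"
  proof (rule Bochner_Integration.integrable_bound)
    show "integrable M (\<lambda>x. indicator B x + \<bar>u x\<bar> powr p)"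
      using Lp Bfin by (auto simp: Lp_function_def integrable_indicator_iff)
    \<comment> \<open>With \<open>B\<close> of finite measure, this bound turns p-th power
      integrability into integrability on \<open>B\<close>, so the means are genuine
      integrals.\<close>
    have "\<bar>u x\<bar> \<le> 1 + \<bar>u x\<bar> powr p" for x
      using powr_mono[of 1 p "\<bar>u x\<bar>"] p
      by (cases "\<bar>u x\<bar> \<le> 1") (auto simp: add_increasing2)
    then show "AE x in M. norm (indicator B x * u x) \<le> norm (indicator B x + \<bar>u x\<bar> powr p)"
      by (auto simp: indicator_def)
  qed measurable
  have \<psi>int: "integrable M \<psi>"
  proof (rule Bochner_Integration.integrable_bound)
    show "integrable M (\<lambda>x. \<Phi> 0 * indicator B x)"
      using Bfin by (auto simp: integrable_indicator_iff)
    show "AE x in M. norm (\<psi> x) \<le> norm (\<Phi> 0 * indicator B x)"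
      using \<phi>le \<phi>0 a0 a_le by (auto simp: \<psi>_def indicator_def)
  qed measurable
  have u\<psi>int: "integrable M (\<lambda>x. u x * \<psi> x)"
  proof (rule Bochner_Integration.integrable_bound)
    show "integrable M (\<lambda>x. \<Phi> 0 * (indicator B x * u x))"
      using uB by simp
    show "AE x in M. norm (u x * \<psi> x) \<le> norm (\<Phi> 0 * (indicator B x * u x))"
      using \<phi>le \<phi>0 a_le a0 by (auto simp: \<psi>_def indicator_def abs_mult mult.commute intro!: mult_right_mono)
  qed measurable
  have ur: "integrable M (\<lambda>x. u x * indicator (ball x0 r) x)" if "r \<le> 1" for r
  proof (rule Bochner_Integration.integrable_bound[OF uB])
    show "AE x in M. norm (u x * indicator (ball x0 r) x) \<le> norm (indicator B x * u x)"
      using that by (auto simp: B_def indicator_def)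
  qed measurable
  have H0: "0 < measure M H"
    using assms(3) ballfin[of "1/2"] by (simp add: H_def measure_def enn2real_positive_iff)
  have HB: "measure M H \<le> measure M B"
    using Bfin by (intro measure_mono_fmeasurable) (auto simp: H_def B_def fmeasurable_def)
  have Q0: "0 \<le> Q" by (simp add: Q_def)
  have \<psi>pos: "0 < (LINT x|M. \<psi> x)"
  proof -
    have "0 < a * measure M H" using a0 H0 by simp
    also have "\<dots> = (LINT x|M. a * indicator H x)" by simp
    also have "\<dots> \<le> (LINT x|M. \<psi> x)"
    proof (rule integral_mono[OF _ \<psi>int])
      show "integrable M (\<lambda>x. a * indicator H x)"
        using ballfin[of "1/2"] by (auto simp: H_def integrable_indicator_iff)
      show "a * indicator H x \<le> \<psi> x" for x
      proof (cases "x \<in> H")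
        case True
        then have "x \<in> B" "dist x x0 < 1/2" by (auto simp: H_def B_def dist_commute)
        then show ?thesis using True \<phi> radial_profile_antimono[OF \<Phi>, of "dist x x0" "1/2"]
          by (simp add: \<psi>_def a_def)
      qed (simp add: \<psi>0)
    qed
    finally show ?thesis .
  qed

  \<comment> \<open>The common centre, the weighted mean and the kernel on the product space\<close>
  define c where "c = mean_on M H u"
  define m where "m = weighted_mean_on M \<phi> B u"
  have m_eq: "m = (LINT x|M. u x * \<psi> x) / (LINT x|M. \<psi> x)"
    by (simp add: m_def weighted_mean_on_def set_lebesgue_integral_def \<psi>_def mult.commute mult.left_commute)
  have c_eq: "c = (LINT x|M. u x * indicator H x) / (LINT x|M. indicator H x)"
    by (simp add: c_def mean_on_def set_lebesgue_integral_def mult.commute)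
  \<comment> \<open>The kernel is measurable on \<open>B \<times> B\<close> only; its extension by
    zero permits Tonelli on the whole product.\<close>
  define k' where "k' = (\<lambda>z. indicator (B \<times> B) z * (case z of (x, y) \<Rightarrow> k x y))"
  have "(\<lambda>z. indicator (B \<times> B) z *\<^sub>R (case z of (x, y) \<Rightarrow> k x y)) \<in> borel_measurable (M \<Otimes>\<^sub>M M)"
    using assms(7) by (subst (asm) borel_measurable_restrict_space_iff) (auto simp: B_def)
  then have [measurable]: "k' \<in> borel_measurable (M \<Otimes>\<^sub>M M)" by (simp add: k'_def)
  define G where "G = (\<lambda>z. ennreal (\<bar>u (fst z) - u (snd z)\<bar> powr p * k' z))"
  have [measurable]: "G \<in> borel_measurable (M \<Otimes>\<^sub>M M)" unfolding G_def by measurable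
  have G_eq: "G (x, y) = ennreal (\<bar>u x - u y\<bar> powr p * k x y)" if "x \<in> B" "y \<in> B" for x y
    using that by (simp add: G_def k'_def)

  \<comment> \<open>The centre \<open>c\<close> does not depend on \<open>s\<close>, so these bounds
    can be integrated over the levels. As \<open>H\<close> lies in \<open>E s\<close>, the deviation
    lemma with the indicators of \<open>H\<close> and \<open>E s\<close> as weights replaces the
    mean over the ball by \<open>c\<close>; the ratio of measures is at most
    \<open>Q\<close>.\<close>
  have ball_bound: "(\<integral>\<^sup>+x\<in>E s. ennreal (\<bar>u x - c\<bar> powr p) \<partial>M)
      \<le> ennreal (2 powr p * Q * C) * (\<integral>\<^sup>+z. G z * indicator (E s \<times> E s) z \<partial>(M \<Otimes>\<^sub>M M))"
    if s: "s < a" for s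
  proof -
    obtain r where r: "1/2 < r" "r \<le> 1" and Er: "E s = ball x0 r"
      using radial_superlevel_eq_ball[OF \<Phi>, of s x0] s E_eq unfolding a_def by metis
    have EB: "E s \<subseteq> B" by (auto simp: E_def)
    have "(\<integral>\<^sup>+x\<in>E s. ennreal (\<bar>u x - c\<bar> powr p) \<partial>M)
        = (\<integral>\<^sup>+x. ennreal (\<bar>u x - c\<bar> powr p * indicator (E s) x) \<partial>M)"
      by (intro nn_integral_cong) (auto simp: indicator_def)
    also have "\<dots> \<le> ennreal (2 powr p * ((LINT x|M. indicator (E s) x) / (LINT x|M. indicator H x)))
        * (\<integral>\<^sup>+x. ennreal (\<bar>u x - mean_on M (ball x0 r) u\<bar> powr p * indicator (E s) x) \<partial>M)"
      unfolding c_eq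
    proof (rule weighted_mean_deviation_le[OF p u])
      show "indicator H x \<le> (indicator (E s) x :: real)" for x
        using r by (auto simp: H_def Er indicator_def)
    qed (use H0 r ballfin[of r] ballfin[of "1/2"] ur[of "1/2"] in
        \<open>auto simp: H_def Er integrable_indicator_iff\<close>)
    also have "\<dots> \<le> ennreal (2 powr p * Q)
        * (\<integral>\<^sup>+x. ennreal (\<bar>u x - mean_on M (ball x0 r) u\<bar> powr p * indicator (E s) x) \<partial>M)"
    proof (intro mult_right_mono ennreal_leI mult_left_mono)
      have "measure M (E s) \<le> measure M B"
        using EB Bfin by (intro measure_mono_fmeasurable) (auto simp: fmeasurable_def)
      then show "(LINT x|M. indicator (E s) x) / (LINT x|M. indicator H x) \<le> Q"
        using H0 by (simp add: Q_def divide_right_mono)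
    qed auto
    also have "(\<integral>\<^sup>+x. ennreal (\<bar>u x - mean_on M (ball x0 r) u\<bar> powr p * indicator (E s) x) \<partial>M)
        = (\<integral>\<^sup>+x\<in>ball x0 r. ennreal (\<bar>u x - mean_on M (ball x0 r) u\<bar> powr p) \<partial>M)"
      by (intro nn_integral_cong) (auto simp: Er indicator_def)
    also have "\<dots> \<le> ennreal C * (\<integral>\<^sup>+x\<in>ball x0 r. (\<integral>\<^sup>+y\<in>ball x0 r.
                 ennreal (\<bar>u x - u y\<bar> powr p * k x y) \<partial>M) \<partial>M)"
      by (rule assms(10)[OF r Lp])
    also have "(\<integral>\<^sup>+x\<in>ball x0 r. (\<integral>\<^sup>+y\<in>ball x0 r. ennreal (\<bar>u x - u y\<bar> powr p * k x y) \<partial>M) \<partial>M)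
        = (\<integral>\<^sup>+x. (\<integral>\<^sup>+y. G (x, y) * indicator (E s \<times> E s) (x, y) \<partial>M) \<partial>M)"
      unfolding Er[symmetric]
    proof (rule nn_integral_cong)
      fix x
      show "(\<integral>\<^sup>+y\<in>E s. ennreal (\<bar>u x - u y\<bar> powr p * k x y) \<partial>M) * indicator (E s) x
          = (\<integral>\<^sup>+y. G (x, y) * indicator (E s \<times> E s) (x, y) \<partial>M)"
        using EB by (cases "x \<in> E s") (auto intro!: nn_integral_cong simp: G_eq subset_iff split: split_indicator)
    qed
    also have "\<dots> = (\<integral>\<^sup>+z. G z * indicator (E s \<times> E s) z \<partial>(M \<Otimes>\<^sub>M M))"
      by (rule M.nn_integral_fst) measurable
    finally show ?thesis
      using Q0 assms(9) by (simp add: mult_left_mono ennreal_mult mult.assoc)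
  qed

  \<comment> \<open>Integration over the levels\<close>
  have "(\<integral>\<^sup>+s. (\<integral>\<^sup>+z. G z *
      indicator {z. 0 < s \<and> s < min (g (fst z)) (g (snd z))} z \<partial>(M \<Otimes>\<^sub>M M)) \<partial>lborel)
      = (\<integral>\<^sup>+z. G z * ennreal (min (g (fst z)) (g (snd z))) \<partial>(M \<Otimes>\<^sub>M M))"
    by (rule nn_integral_layer_cake[symmetric]) (use MM.sigma_finite_measure_axioms in measurable)
  also have "\<dots> = (\<integral>\<^sup>+x. (\<integral>\<^sup>+y. G (x, y) * ennreal (min (g x) (g y)) \<partial>M) \<partial>M)"
    by (subst M.nn_integral_fst[symmetric]) simp_all
  \<comment> \<open>\<open>G\<close> vanishes off \<open>B \<times> B\<close>, and on
    \<open>B\<close> the truncation \<open>g\<close> lies below \<open>\<phi>\<close>.\<close>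
  also have "\<dots> \<le> (\<integral>\<^sup>+x\<in>B. (\<integral>\<^sup>+y\<in>B.
      ennreal (\<bar>u x - u y\<bar> powr p * k x y * min (\<phi> y) (\<phi> x)) \<partial>M) \<partial>M)"
  proof (rule nn_integral_mono)
    fix x
    show "(\<integral>\<^sup>+y. G (x, y) * ennreal (min (g x) (g y)) \<partial>M) \<le> (\<integral>\<^sup>+y\<in>B.
        ennreal (\<bar>u x - u y\<bar> powr p * k x y * min (\<phi> y) (\<phi> x)) \<partial>M) * indicator B x"
    proof (cases "x \<in> B")
      case True
      have "G (x, y) * ennreal (min (g x) (g y))
          \<le> ennreal (\<bar>u x - u y\<bar> powr p * k x y * min (\<phi> y) (\<phi> x)) * indicator B y" for y
      proof (cases "y \<in> B")
        case y: True
        have "0 \<le> k x y" using assms(8) True y by (simp add: B_def)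
        moreover have "min (g x) (g y) \<le> min (\<phi> y) (\<phi> x)"
          using True y by (auto simp: g_def \<psi>_def)
        ultimately show ?thesis
          using True y g0 by (simp add: G_eq ennreal_mult[symmetric] ennreal_leI mult_left_mono)
      qed (simp add: G_def k'_def)
      then show ?thesis using True by (simp add: nn_integral_mono)
    qed (simp add: G_def k'_def)
  qed
  finally have energy: "(\<integral>\<^sup>+s. (\<integral>\<^sup>+z. G z *
      indicator {z. 0 < s \<and> s < min (g (fst z)) (g (snd z))} z \<partial>(M \<Otimes>\<^sub>M M)) \<partial>lborel)
      \<le> (\<integral>\<^sup>+x\<in>B. (\<integral>\<^sup>+y\<in>B.
      ennreal (\<bar>u x - u y\<bar> powr p * k x y * min (\<phi> y) (\<phi> x)) \<partial>M) \<partial>M)" .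

  have "(\<integral>\<^sup>+x. ennreal (\<bar>u x - c\<bar> powr p) * ennreal (g x) \<partial>M)
      = (\<integral>\<^sup>+s. (\<integral>\<^sup>+x. ennreal (\<bar>u x - c\<bar> powr p) * indicator {x. 0 < s \<and> s < g x} x \<partial>M) \<partial>lborel)"
    by (rule nn_integral_layer_cake) (use assms(2) in measurable)
  also have "\<dots> \<le> (\<integral>\<^sup>+s. ennreal (2 powr p * Q * C) * (\<integral>\<^sup>+z. G z *
      indicator {z. 0 < s \<and> s < min (g (fst z)) (g (snd z))} z \<partial>(M \<Otimes>\<^sub>M M)) \<partial>lborel)"
  proof (rule nn_integral_mono)
    fix s :: real
    show "(\<integral>\<^sup>+x. ennreal (\<bar>u x - c\<bar> powr p) * indicator {x. 0 < s \<and> s < g x} x \<partial>M)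
      \<le> ennreal (2 powr p * Q * C) * (\<integral>\<^sup>+z. G z *
      indicator {z. 0 < s \<and> s < min (g (fst z)) (g (snd z))} z \<partial>(M \<Otimes>\<^sub>M M))"
    \<comment> \<open>Within this range a minimum exceeds \<open>s\<close> exactly when both points
      lie in \<open>E s\<close>, so the level set in the product is a square. Outside it, the left
      side is zero.\<close>
    proof (cases "0 < s \<and> s < a")
      case True
      have gE: "s < g x \<longleftrightarrow> x \<in> E s" for x using layer[of s x] True by blast
      then have "{x. 0 < s \<and> s < g x} = E s" using True by auto
      moreover have "{z. 0 < s \<and> s < min (g (fst z)) (g (snd z))} = E s \<times> E s"
        using True by (auto simp: gE)
      ultimately show ?thesis using ball_bound True by simp
    next
      case False
      then have "{x. 0 < s \<and> s < g x} = {}" using layer by blast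
      then show ?thesis by simp
    qed
  qed
  also have "\<dots> = ennreal (2 powr p * Q * C) * (\<integral>\<^sup>+s. (\<integral>\<^sup>+z. G z *
      indicator {z. 0 < s \<and> s < min (g (fst z)) (g (snd z))} z \<partial>(M \<Otimes>\<^sub>M M)) \<partial>lborel)"
    by (rule nn_integral_cmult) (simp add: indicator_def)
  also have "\<dots> \<le> ennreal (2 powr p * Q * C) * (\<integral>\<^sup>+x\<in>B. (\<integral>\<^sup>+y\<in>B.
      ennreal (\<bar>u x - u y\<bar> powr p * k x y * min (\<phi> y) (\<phi> x)) \<partial>M) \<partial>M)"
    using energy by (rule mult_left_mono) simp
  finally have layers: "(\<integral>\<^sup>+x. ennreal (\<bar>u x - c\<bar> powr p) * ennreal (g x) \<partial>M)
      \<le> ennreal (2 powr p * Q * C) * (\<integral>\<^sup>+x\<in>B. (\<integral>\<^sup>+y\<in>B.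
      ennreal (\<bar>u x - u y\<bar> powr p * k x y * min (\<phi> y) (\<phi> x)) \<partial>M) \<partial>M)" .

  \<comment> \<open>Passage to the weighted mean and collection of the constants\<close>
  have "(\<integral>\<^sup>+x\<in>B. ennreal (\<bar>u x - m\<bar> powr p * \<phi> x) \<partial>M) = (\<integral>\<^sup>+x. ennreal (\<bar>u x - m\<bar> powr p * \<psi> x) \<partial>M)"
    by (intro nn_integral_cong) (auto simp: \<psi>_def indicator_def)
  \<comment> \<open>Here both weights in the deviation lemma equal \<open>\<psi>\<close>, so the
    ratio of total weights is 1.\<close>
  also have "\<dots> \<le> ennreal (2 powr p) * (\<integral>\<^sup>+x. ennreal (\<bar>u x - c\<bar> powr p * \<psi> x) \<partial>M)"
    unfolding m_eq
    using weighted_mean_deviation_le[OF p u \<psi>int \<psi>int \<psi>0 order_refl u\<psi>int \<psi>pos, of c] \<psi>pos by simp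
  also have "\<dots> \<le> ennreal (2 powr p) * (\<integral>\<^sup>+x. ennreal D * (ennreal (\<bar>u x - c\<bar> powr p) * ennreal (g x)) \<partial>M)"
  proof (intro mult_left_mono nn_integral_mono)
    fix x
    show "ennreal (\<bar>u x - c\<bar> powr p * \<psi> x) \<le> ennreal D * (ennreal (\<bar>u x - c\<bar> powr p) * ennreal (g x))"
      using mult_left_mono[OF \<psi>g[of x], of "\<bar>u x - c\<bar> powr p"] D1 g0[of x]
      by (simp add: ennreal_mult[symmetric] mult.left_commute ennreal_leI)
  qed simp
  also have "\<dots> = ennreal (2 powr p * D) * (\<integral>\<^sup>+x. ennreal (\<bar>u x - c\<bar> powr p) * ennreal (g x) \<partial>M)"
    using D1 by (simp add: nn_integral_cmult ennreal_mult mult.assoc)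
  also have "\<dots> \<le> ennreal (2 powr p * D) * (ennreal (2 powr p * Q * C) * (\<integral>\<^sup>+x\<in>B. (\<integral>\<^sup>+y\<in>B.
      ennreal (\<bar>u x - u y\<bar> powr p * k x y * min (\<phi> y) (\<phi> x)) \<partial>M) \<partial>M))"
    using layers by (rule mult_left_mono) simp
  finally have main: "(\<integral>\<^sup>+x\<in>B. ennreal (\<bar>u x - m\<bar> powr p * \<phi> x) \<partial>M)
      \<le> ennreal (2 powr p * D) * (ennreal (2 powr p * Q * C) * (\<integral>\<^sup>+x\<in>B. (\<integral>\<^sup>+y\<in>B.
      ennreal (\<bar>u x - u y\<bar> powr p * k x y * min (\<phi> y) (\<phi> x)) \<partial>M) \<partial>M))" .
  \<comment> \<open>The two changes of centre contribute \<open>2 powr p\<close> each, together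
    \<open>4 powr p\<close>, which is bounded by the \<open>8 powr p\<close> of the claim.\<close>
  have "2 powr p * D * (2 powr p * Q * C) = C * ((2 powr p * 2 powr p) * Q * D)"
    by (simp only: mult_ac)
  also have "\<dots> = C * (4 powr p * Q * D)"
    by (simp only: powr_mult[symmetric]) simp
  also have "\<dots> \<le> C * (8 powr p * Q * D)"
    using D1 Q0 assms(9) p by (intro mult_left_mono mult_right_mono powr_mono2) auto
  finally have "ennreal (2 powr p * D) * ennreal (2 powr p * Q * C) \<le> ennreal (C * (8 powr p * Q * D))"
    using D1 Q0 assms(9) by (simp add: ennreal_mult[symmetric] ennreal_leI)
  then have "ennreal (2 powr p * D) * (ennreal (2 powr p * Q * C) * (\<integral>\<^sup>+x\<in>B. (\<integral>\<^sup>+y\<in>B.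
      ennreal (\<bar>u x - u y\<bar> powr p * k x y * min (\<phi> y) (\<phi> x)) \<partial>M) \<partial>M))
      \<le> ennreal (C * (8 powr p * Q * D)) * (\<integral>\<^sup>+x\<in>B. (\<integral>\<^sup>+y\<in>B.
      ennreal (\<bar>u x - u y\<bar> powr p * k x y * min (\<phi> y) (\<phi> x)) \<partial>M) \<partial>M)"
    unfolding mult.assoc[symmetric] by (rule mult_right_mono) simp
  with main have "(\<integral>\<^sup>+x\<in>B. ennreal (\<bar>u x - m\<bar> powr p * \<phi> x) \<partial>M)
      \<le> ennreal (C * (8 powr p * Q * D)) * (\<integral>\<^sup>+x\<in>B. (\<integral>\<^sup>+y\<in>B.
      ennreal (\<bar>u x - u y\<bar> powr p * k x y * min (\<phi> y) (\<phi> x)) \<partial>M) \<partial>M)"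
    by (rule order_trans)
  then show "(\<integral>\<^sup>+x\<in>ball x0 1.
               ennreal (\<bar>u x - weighted_mean_on M \<phi> (ball x0 1) u\<bar> powr p * \<phi> x) \<partial>M)
           \<le> ennreal (C * (8 powr p * measure M (ball x0 1) / measure M (ball x0 (1/2))
                            * (\<Phi> 0 / \<Phi> (1/2)))) *
             (\<integral>\<^sup>+x\<in>ball x0 1. (\<integral>\<^sup>+y\<in>ball x0 1.
                 ennreal (\<bar>u x - u y\<bar> powr p * k x y * min (\<phi> y) (\<phi> x)) \<partial>M) \<partial>M)"
    unfolding m_def B_def H_def Q_def D_def a_def times_divide_eq_right .
qed

end
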